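(* Let $X$ be a normed space, let $m\ge2$, and let $P:X\to X$ be a continuous $m$-homogeneous polynomial. Then the following subsets of $X$ are always nowhere dense: any orbit $Orb_P(x)$ $(x\in X)$ induced by $P$; the set of irregular vectors of $P$; the set of periodic vectors of $P$.
   Context: A map $P:X\to X$ is an $m$-homogeneous polynomial if $P(x)=A(x,\dots,x)$ for some $m$-linear map $A:X^m\to X$. $P^n$ denotes the $n$-th iterate of $P$ and $Orb_P(x)=\{P^n(x):n\in\mathbb N_0\}$. The norm of $P$ is $\|P\|=\sup_{x\in B_X}\|P(x)\|$, where $B_X$ is the unit ball of $X$, and the limit radius of $P$ is $r_P=\|P\|^{1/(1-m)}$. A vector $x$ is irregular for $P$ if $\liminf_n\|P^n(x)\|=r_P$ and $\limsup_n\|P^n(x)\|=\infty$. A vector $x$ is periodic if $P^n(x)=x$ for some $n\ge1$. A set is nowhere dense if its closure has empty interior. *)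

theory Defs
  imports "HOL-Analysis.Analysis"
begin

text \<open>
  A normed space over a scalar field \<open>'k\<close>. By the Gelfand--Mazur theorem the instances of
  \<^class>\<open>real_normed_field\<close> are, up to isometric isomorphism, exactly the real and the complex
  numbers. The class \<^class>\<open>real_normed_vector\<close> supplies the additive group and the norm
  (completeness is not assumed); its real scaling is the restriction of \<open>smul\<close>.
\<close>

locale normed_space_over = vector_space smul
  for smul :: "'k::real_normed_field \<Rightarrow> 'a::real_normed_vector \<Rightarrow> 'a" +
  assumes norm_scale: "norm (smul c x) = norm c * norm x"
    and scale_of_real: "smul (of_real r) x = r *\<^sub>R x"

text \<open>
  Elements of \<open>X\<^sup>m\<close> are lists of length \<open>m\<close>; the values of \<open>A\<close> at other lists are irrelevant.
\<close>

definition multilinear_map ::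
  "('k::field \<Rightarrow> 'a::ab_group_add \<Rightarrow> 'a) \<Rightarrow> nat \<Rightarrow> ('a list \<Rightarrow> 'a) \<Rightarrow> bool" where
  "multilinear_map smul m A \<longleftrightarrow>
     (\<forall>xs i. length xs = m \<longrightarrow> i < m \<longrightarrow>
        Vector_Spaces.linear smul smul (\<lambda>t. A (xs[i := t])))"

definition homogeneous_polynomial ::
  "('k::field \<Rightarrow> 'a::ab_group_add \<Rightarrow> 'a) \<Rightarrow> nat \<Rightarrow> ('a \<Rightarrow> 'a) \<Rightarrow> bool" where
  "homogeneous_polynomial smul m P \<longleftrightarrow>
     (\<exists>A. multilinear_map smul m A \<and> (\<forall>x. P x = A (replicate m x)))"

definition poly_orbit :: "('a \<Rightarrow> 'a) \<Rightarrow> 'a \<Rightarrow> 'a set" where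
  "poly_orbit P x = {(P ^^ n) x | n. True}"

text \<open>The supremum is finite when \<open>P\<close> is a continuous homogeneous polynomial.\<close>

definition poly_norm :: "('a::real_normed_vector \<Rightarrow> 'a) \<Rightarrow> real" where
  "poly_norm P = (SUP x\<in>cball 0 1. norm (P x))"

text \<open>
  For \<open>m \<ge> 2\<close> the exponent \<open>1 / (1 - m)\<close> is negative, so \<open>P = 0\<close> has limit radius \<open>\<infinity>\<close>.
  This case is split off because \<^term>\<open>0 powr a = (0::real)\<close> for every \<open>a\<close>.
\<close>

definition limit_radius :: "nat \<Rightarrow> ('a::real_normed_vector \<Rightarrow> 'a) \<Rightarrow> ereal" where
  "limit_radius m P =
     (if poly_norm P = 0 then \<infinity> else ereal (poly_norm P powr (1 / (1 - real m))))"

definition irregular_vector :: "nat \<Rightarrow> ('a::real_normed_vector \<Rightarrow> 'a) \<Rightarrow> 'a \<Rightarrow> bool" where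
  "irregular_vector m P x \<longleftrightarrow>
     liminf (\<lambda>n. ereal (norm ((P ^^ n) x))) = limit_radius m P \<and>
     limsup (\<lambda>n. ereal (norm ((P ^^ n) x))) = \<infinity>"

definition periodic_vector :: "('a \<Rightarrow> 'a) \<Rightarrow> 'a \<Rightarrow> bool" where
  "periodic_vector P x \<longleftrightarrow> (\<exists>n\<ge>1. (P ^^ n) x = x)"

definition nowhere_dense :: "'a::topological_space set \<Rightarrow> bool" where
  "nowhere_dense S \<longleftrightarrow> interior (closure S) = {}"

end

(* Near 0 the map P is a contraction, so the set F of points whose orbit stays away from 0 is
   closed. Since P^n (c x) = c^(m^n) P^n x, if x / t lies in F for some t > 1, then the norms
   |P^n x| tend to infinity. A set S contained in F and {0} whose nonzero points have orbits not
   tending to infinity therefore cannot be dense in an open set: a point x of S in this open set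
   could be shrunk within it, and the shrunk point would lie in F. This covers the irregular and the
   periodic vectors and those orbits that tend neither to 0 nor to infinity; the other orbits
   have no nonzero accumulation points. *)

theory Submission
  imports Defs
begin

section \<open>Homogeneity and continuity of the iterates\<close>

lemma homogeneous_polynomial_scaleR:
  assumes "normed_space_over smul" and "homogeneous_polynomial smul m P"
  shows "P (c *\<^sub>R x) = c ^ m *\<^sub>R P x"
proof -
  interpret normed_space_over smul by fact
  obtain A where A: "multilinear_map smul m A" and P: "\<And>x. P x = A (replicate m x)"
    using assms(2) unfolding homogeneous_polynomial_def by blast
  \<comment> \<open>Scale the arguments one slot at a time: linearity in slot \<open>j\<close> pulls
    out one further factor \<open>c\<close>.\<close>
  have "A (replicate j (c *\<^sub>R x) @ replicate (m - j) x) = c ^ j *\<^sub>R A (replicate m x)"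
    if "j \<le> m" for j
    using that
  proof (induction j)
    case (Suc j)
    let ?xs = "replicate j (c *\<^sub>R x) @ replicate (m - j) x"
    have "m - j = Suc (m - Suc j)" using Suc.prems by simp
    then have rest: "replicate (m - j) x = x # replicate (m - Suc j) x"
      by (simp only: replicate_Suc)
    \<comment> \<open>The current list and the next one are both updates of slot \<open>j\<close>,
      by \<open>x\<close> and by a multiple of \<open>x\<close>, so a single linear map in
      \<open>t\<close> compares them.\<close>
    have upd: "?xs[j := t] = replicate j (c *\<^sub>R x) @ t # replicate (m - Suc j) x" for t
      unfolding rest by (simp add: list_update_append)
    have "Vector_Spaces.linear smul smul (\<lambda>t. A (?xs[j := t]))"
      using A Suc.prems unfolding multilinear_map_def by simp
    then interpret lin: Vector_Spaces.linear smul smul "\<lambda>t. A (?xs[j := t])" .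
    have "A (replicate (Suc j) (c *\<^sub>R x) @ replicate (m - Suc j) x) = A (?xs[j := c *\<^sub>R x])"
      by (simp only: upd) (simp add: replicate_app_Cons_same)
    also have "\<dots> = c *\<^sub>R A (?xs[j := x])"
      using lin.scale[of "of_real c" x] by (simp only: scale_of_real)
    also have "c *\<^sub>R A (?xs[j := x]) = c *\<^sub>R A ?xs"
      by (simp only: upd) (simp only: rest)
    also have "c *\<^sub>R A ?xs = c ^ Suc j *\<^sub>R A (replicate m x)"
      using Suc by simp
    finally show ?case .
  qed simp
  from this[of m] show ?thesis by (simp add: P)
qed

lemma funpow_scaleR:
  fixes P :: "'a::real_vector \<Rightarrow> 'a"
  assumes "\<And>c x. P (c *\<^sub>R x) = c ^ m *\<^sub>R P x"
  shows "(P ^^ n) (c *\<^sub>R x) = c ^ (m ^ n) *\<^sub>R (P ^^ n) x"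
  by (induction n) (simp_all add: assms mult.commute flip: power_mult)

lemma continuous_on_funpow:
  fixes P :: "'a::topological_space \<Rightarrow> 'a"
  assumes "continuous_on UNIV P"
  shows "continuous_on UNIV (P ^^ n)"
proof (induction n)
  case (Suc n)
  then show ?case
    using continuous_on_compose2[OF assms Suc] by (simp add: comp_def)
qed (simp add: id_def)

section \<open>Attraction by the origin\<close>

text \<open>Continuity at 0 and homogeneity bound \<open>norm (P y)\<close> by a multiple of
  \<open>norm y ^ m\<close>. Since \<open>m\<close> is at least 2, this is of smaller order than
  \<open>norm y\<close> near 0.\<close>

lemma homogeneous_contraction_near_0:
  fixes P :: "'a::real_normed_vector \<Rightarrow> 'a"
  assumes hom: "\<And>c x. P (c *\<^sub>R x) = c ^ m *\<^sub>R P x"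
    and "m \<ge> 2" and cont: "continuous_on UNIV P"
  obtains \<delta> where "\<delta> > 0" "\<And>y. norm y < \<delta> \<Longrightarrow> norm (P y) \<le> norm y / 2"
proof -
  have P0: "P 0 = 0" using hom[of 0 0] \<open>m \<ge> 2\<close> by (simp add: power_0_left)
  have "isCont P 0" using cont by (simp add: continuous_on_eq_continuous_at)
  then obtain d where d: "d > 0" "\<And>y. norm y < d \<Longrightarrow> norm (P y) < 1"
    unfolding continuous_at_eps_delta using P0 zero_less_one by (metis dist_0_norm dist_commute)
  \<comment> \<open>The constant comes from rescaling \<open>y\<close> to norm \<open>d / 2\<close>,
    where \<open>P\<close> takes values of norm below 1.\<close>
  define C where "C = (2 / d) ^ m"
  have C: "C > 0" using d by (simp add: C_def)
  have bound: "norm (P y) \<le> C * norm y ^ m" for y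
  proof (cases "y = 0")
    case False
    define z where "z = (d / (2 * norm y)) *\<^sub>R y"
    have "norm z < d" using d False by (simp add: z_def)
    then have z: "norm (P z) \<le> 1" using d by (simp add: less_imp_le)
    have y: "y = (2 * norm y / d) *\<^sub>R z" using d False by (simp add: z_def)
    have "norm (P y) = (2 * norm y / d) ^ m * norm (P z)"
      using d by (subst y, subst hom) simp
    also have "\<dots> \<le> (2 * norm y / d) ^ m" using z d by (intro mult_left_le) auto
    also have "\<dots> = C * norm y ^ m" by (simp add: C_def power_mult_distrib power_divide)
    finally show ?thesis .
  qed (use P0 C in simp)
  show thesis
  proof
    \<comment> \<open>The bound 1 lets the exponent \<open>m\<close> drop to 2; the other bound
      makes the remaining factor \<open>C * norm y\<close> at most 1/2.\<close>
    show "min 1 (1 / (2 * C)) > 0" using C by simp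
    fix y :: 'a assume y: "norm y < min 1 (1 / (2 * C))"
    have "norm y ^ m \<le> norm y ^ 2" using y \<open>m \<ge> 2\<close> by (intro power_decreasing) auto
    then have "norm (P y) \<le> C * norm y ^ 2" using bound[of y] C
      by (meson dual_order.trans less_imp_le mult_left_mono)
    also have "\<dots> = (C * norm y) * norm y" by (simp add: power2_eq_square)
    also have "\<dots> \<le> (1 / 2) * norm y" using y C
      by (intro mult_right_mono) (auto simp: field_simps)
    finally show "norm (P y) \<le> norm y / 2" by simp
  qed
qed

text \<open>The \<delta>-ball about 0 is mapped into itself with norms at least halved, so a single
  visit decides the limit. Conversely, an orbit that does not tend to 0 never enters this
  ball.\<close>

lemma funpow_tendsto_0:
  fixes P :: "'a::real_normed_vector \<Rightarrow> 'a"
  assumes contr: "\<And>y. norm y < \<delta> \<Longrightarrow> norm (P y) \<le> norm y / 2"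
    and k: "norm ((P ^^ k) x) < \<delta>"
  shows "(\<lambda>n. norm ((P ^^ n) x)) \<longlonglongrightarrow> 0"
proof -
  \<comment> \<open>The second conjunct keeps the orbit where \<open>contr\<close> applies.\<close>
  have *: "norm ((P ^^ (n + k)) x) \<le> (1 / 2) ^ n * norm ((P ^^ k) x)
           \<and> norm ((P ^^ (n + k)) x) < \<delta>" for n
  proof (induction n)
    case (Suc n)
    have half: "norm ((P ^^ (Suc n + k)) x) \<le> norm ((P ^^ (n + k)) x) / 2"
      using contr Suc by simp
    also have "norm ((P ^^ (n + k)) x) / 2 \<le> norm ((P ^^ (n + k)) x)" by simp
    ultimately have "norm ((P ^^ (Suc n + k)) x) < \<delta>" using Suc by linarith
    with half Suc show ?case by (auto simp del: funpow.simps)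
  qed (use k in simp)
  have lim: "(\<lambda>n. (1 / 2) ^ n * norm ((P ^^ k) x)) \<longlonglongrightarrow> 0"
    by (intro tendsto_mult_left_zero LIMSEQ_power_zero) simp
  have "(\<lambda>n. norm ((P ^^ (n + k)) x)) \<longlonglongrightarrow> 0"
    by (rule tendsto_sandwich[OF _ _ tendsto_const lim]) (use * in auto)
  then show ?thesis by (rule LIMSEQ_offset)
qed

section \<open>Criteria for nowhere density\<close>

text \<open>A nonempty open set contains a short segment in the direction of \<open>w\<close>. In
  the zero space this fails, as {0} is open there.\<close>

lemma infinite_open_normed:
  fixes w :: "'a::real_normed_vector"
  assumes "w \<noteq> 0" "open U" "(v::'a) \<in> U"
  shows "infinite U"
proof
  assume fin: "finite U"
  obtain e where e: "e > 0" "ball v e \<subseteq> U" using assms openE by blast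
  have "(\<lambda>c. v + c *\<^sub>R w) ` {0<..<e / norm w} \<subseteq> ball v e"
    using assms(1) by (auto simp: dist_norm field_simps)
  with e fin have "finite ((\<lambda>c. v + c *\<^sub>R w) ` {0<..<e / norm w})"
    by (meson finite_subset)
  moreover have "inj_on (\<lambda>c. v + c *\<^sub>R w) {0<..<e / norm w}"
    using assms(1) by (auto intro: inj_onI)
  ultimately show False using e assms(1) infinite_Ioo[of 0 "e / norm w"]
    by (simp add: finite_image_iff)
qed

lemma nowhere_dense_if_shrinking_escapes:
  fixes P :: "'a::real_normed_vector \<Rightarrow> 'a"
  assumes hom: "\<And>c x. P (c *\<^sub>R x) = c ^ m *\<^sub>R P x"
    and "m \<ge> 2" and cont: "continuous_on UNIV P"
    and w: "(w::'a) \<noteq> 0" and "\<delta> > 0"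
    and away: "\<And>x n. x \<in> S \<Longrightarrow> x \<noteq> 0 \<Longrightarrow> \<delta> \<le> norm ((P ^^ n) x)"
    and no_escape: "\<And>x. x \<in> S \<Longrightarrow> x \<noteq> 0 \<Longrightarrow> \<not> filterlim (\<lambda>n. norm ((P ^^ n) x)) at_top sequentially"
  shows "nowhere_dense S"
proof (rule ccontr)
  define F where "F = {x. \<forall>n. \<delta> \<le> norm ((P ^^ n) x)}"
  define U where "U = interior (closure S) - {0}"
  assume "\<not> nowhere_dense S"
  then obtain v where "v \<in> interior (closure S)" unfolding nowhere_dense_def by blast
  then have "infinite (interior (closure S))"
    using infinite_open_normed[OF w open_interior] by blast
  \<comment> \<open>An infinite set survives the removal of 0. Keeping 0 out of \<open>U\<close>
    later places the shrunk point in \<open>F\<close> itself.\<close>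
  then have "U \<noteq> {}" unfolding U_def by (metis Diff_infinite_finite finite.simps)
  moreover have U: "open U" unfolding U_def by (intro open_Diff) auto
  moreover have "U \<subseteq> closure S" unfolding U_def using interior_subset by blast
  ultimately obtain x where x: "x \<in> S" "x \<in> U"
    by (metis Int_iff disjoint_iff inf.absorb_iff1 open_Int_closure_eq_empty equals0I)
  have x0: "x \<noteq> 0" using x by (simp add: U_def)
  have "closed F" unfolding F_def
    by (intro closed_Collect_all closed_Collect_le continuous_intros continuous_on_funpow cont)
  then have "closed (insert 0 F)" by simp
  moreover have "S \<subseteq> insert 0 F" using away by (auto simp: F_def)
  ultimately have cl: "closure S \<subseteq> insert 0 F" by (rule closure_minimal[rotated])
  obtain e where e: "e > 0" "ball x e \<subseteq> U" using U x openE by blast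
  \<comment> \<open>The bound 1/2 keeps \<open>1 - a\<close> positive; the other one moves
    \<open>x\<close> by at most \<open>e / 2\<close>, so the shrunk point stays in the ball.\<close>
  define a where "a = min (1 / 2) (e / (2 * norm x))"
  have a: "0 < a" "a < 1" using e x0 by (auto simp: a_def)
  have "a * norm x \<le> e / (2 * norm x) * norm x" by (intro mult_right_mono) (auto simp: a_def)
  then have "a * norm x < e" using e x0 by simp
  then have "(1 - a) *\<^sub>R x \<in> ball x e" using a by (simp add: dist_norm scaleR_diff_left)
  then have "(1 - a) *\<^sub>R x \<in> F" using e \<open>U \<subseteq> closure S\<close> cl U_def by blast
  then have low: "\<delta> \<le> (1 - a) ^ (m ^ n) * norm ((P ^^ n) x)" for n
    using a by (simp add: F_def funpow_scaleR[of P m, OF hom])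
  define t where "t = 1 / (1 - a)"
  have t: "t > 1" using a by (simp add: t_def)
  \<comment> \<open>The exponent \<open>m ^ n\<close> dominates \<open>n\<close>, so geometric
    growth already suffices for divergence.\<close>
  have "t ^ n * \<delta> \<le> norm ((P ^^ n) x)" for n
  proof -
    have "n < 2 ^ n" by (rule less_exp)
    also have "2 ^ n \<le> m ^ n" using \<open>m \<ge> 2\<close> by (rule power_mono) simp
    finally have "t ^ n \<le> t ^ (m ^ n)" using t by (intro power_increasing) auto
    then have "t ^ n * \<delta> \<le> t ^ (m ^ n) * \<delta>" using \<open>\<delta> > 0\<close> by simp
    also have "\<dots> \<le> norm ((P ^^ n) x)"
      using low[of n] a by (simp add: t_def power_divide field_simps)
    finally show ?thesis .
  qed
  moreover have "filterlim (\<lambda>n. t ^ n * \<delta>) at_top sequentially"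
  proof (rule filterlim_at_top_mult_tendsto_pos[OF tendsto_const \<open>\<delta> > 0\<close>])
    have "\<forall>\<^sub>F n in sequentially. 0 < t ^ n" using t by simp
    with t show "filterlim (\<lambda>n. t ^ n) at_top sequentially"
      by (intro filterlim_at_infinity_imp_filterlim_at_top filterlim_realpow_sequentially_gt1) auto
  qed
  ultimately have "filterlim (\<lambda>n. norm ((P ^^ n) x)) at_top sequentially"
    by (auto intro: filterlim_at_top_mono)
  then show False using no_escape x x0 by blast
qed

text \<open>If the closure had interior, the range would be dense in a small open set around some
  nonzero \<open>v\<close> but meet it in a finite set, making that open set finite. Exempting the
  origin admits sequences that tend to 0.\<close>

lemma nowhere_dense_range_if_finite_near:
  fixes f :: "nat \<Rightarrow> 'a::real_normed_vector"
  assumes w: "(w::'a) \<noteq> 0"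
    and fin: "\<And>v. v \<noteq> 0 \<Longrightarrow> \<exists>e>0. finite {n. f n \<in> ball v e}"
  shows "nowhere_dense (range f)"
proof (rule ccontr)
  assume "\<not> nowhere_dense (range f)"
  then obtain u where "u \<in> interior (closure (range f))" unfolding nowhere_dense_def by blast
  then have "infinite (interior (closure (range f)))"
    using infinite_open_normed[OF w open_interior] by blast
  then obtain v where v: "v \<in> interior (closure (range f))" "v \<noteq> 0"
    by (metis finite.emptyI finite_insert finite_subset insertCI subsetI)
  then obtain e where e: "e > 0" "finite {n. f n \<in> ball v e}" using fin by blast
  define B where "B = ball v e \<inter> interior (closure (range f))"
  have B: "open B" "v \<in> B" using e v by (auto simp: B_def)
  have "B \<subseteq> closure (range f)" using interior_subset by (auto simp: B_def)
  then have "B \<subseteq> closure (B \<inter> range f)"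
    using open_Int_closure_subset[OF B(1), of "range f"] by blast
  moreover have "finite (B \<inter> range f)"
    by (rule finite_subset[OF _ finite_imageI[OF e(2), of f]]) (auto simp: B_def)
  ultimately have "finite B" by (metis closure_closed finite_imp_closed finite_subset)
  then show False using infinite_open_normed[OF w B] by blast
qed

text \<open>Late terms have norm below half of \<open>norm v\<close>, hence lie farther than that
  from \<open>v\<close>.\<close>

lemma nowhere_dense_range_if_tendsto_0:
  fixes f :: "nat \<Rightarrow> 'a::real_normed_vector"
  assumes "(w::'a) \<noteq> 0" and lim: "(\<lambda>n. norm (f n)) \<longlonglongrightarrow> 0"
  shows "nowhere_dense (range f)"
proof (rule nowhere_dense_range_if_finite_near[OF assms(1)])
  fix v :: 'a assume v: "v \<noteq> 0"
  have "\<forall>\<^sub>F n in sequentially. norm (f n) < norm v / 2"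
    using lim v by (intro order_tendstoD) auto
  then obtain N where N: "\<And>n. n \<ge> N \<Longrightarrow> norm (f n) < norm v / 2"
    unfolding eventually_sequentially by blast
  have "n < N" if "f n \<in> ball v (norm v / 2)" for n
  proof (rule ccontr)
    assume "\<not> n < N"
    then have "norm (f n) < norm v / 2" using N by simp
    then show False using that norm_triangle_sub[of v "f n"] by (simp add: dist_norm)
  qed
  then have "finite {n. f n \<in> ball v (norm v / 2)}"
    by (intro bounded_nat_set_is_finite) blast
  then show "\<exists>e>0. finite {n. f n \<in> ball v e}" using v by (intro exI[of _ "norm v / 2"]) simp
qed

lemma nowhere_dense_range_if_norm_at_top:
  fixes f :: "nat \<Rightarrow> 'a::real_normed_vector"
  assumes "(w::'a) \<noteq> 0" and lim: "filterlim (\<lambda>n. norm (f n)) at_top sequentially"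
  shows "nowhere_dense (range f)"
proof (rule nowhere_dense_range_if_finite_near[OF assms(1)])
  fix v :: 'a
  have "\<forall>\<^sub>F n in sequentially. norm v + 1 \<le> norm (f n)"
    using lim by (simp add: filterlim_at_top)
  then obtain N where N: "\<And>n. n \<ge> N \<Longrightarrow> norm v + 1 \<le> norm (f n)"
    unfolding eventually_sequentially by blast
  have "n < N" if "f n \<in> ball v 1" for n
  proof (rule ccontr)
    assume "\<not> n < N"
    then have "norm v + 1 \<le> norm (f n)" using N by simp
    then show False using that norm_triangle_sub[of "f n" v]
      by (simp add: dist_norm norm_minus_commute)
  qed
  then have "finite {n. f n \<in> ball v 1}"
    by (intro bounded_nat_set_is_finite) blast
  then show "\<exists>e>0. finite {n. f n \<in> ball v e}" by (intro exI[of _ 1]) simp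
qed

section \<open>Limits along irregular and periodic orbits\<close>

text \<open>The infinite limsup excludes the limit 0. Norms tending to infinity would make the
  liminf, and so the limit radius, infinite; this forces \<open>P\<close> to vanish, and then every
  orbit tends to 0.\<close>

lemma irregular_vector_limits:
  fixes P :: "'a::real_normed_vector \<Rightarrow> 'a"
  assumes hom: "\<And>c x. P (c *\<^sub>R x) = c ^ m *\<^sub>R P x"
    and "m \<ge> 2" and cont: "continuous_on UNIV P"
    and irr: "irregular_vector m P x"
  shows "\<not> (\<lambda>n. norm ((P ^^ n) x)) \<longlonglongrightarrow> 0"
    and "\<not> filterlim (\<lambda>n. norm ((P ^^ n) x)) at_top sequentially"
proof -
  let ?f = "\<lambda>n. norm ((P ^^ n) x)"
  have lsup: "limsup (\<lambda>n. ereal (?f n)) = \<infinity>" using irr by (simp add: irregular_vector_def)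
  show not0: "\<not> ?f \<longlonglongrightarrow> 0"
  proof
    assume "?f \<longlonglongrightarrow> 0"
    then have "(\<lambda>n. ereal (?f n)) \<longlonglongrightarrow> ereal 0" by (simp only: lim_ereal)
    then have "limsup (\<lambda>n. ereal (?f n)) = ereal 0" by (intro lim_imp_Limsup) auto
    then show False using lsup by simp
  qed
  show "\<not> filterlim ?f at_top sequentially"
  proof
    assume "filterlim ?f at_top sequentially"
    then have "(\<lambda>n. ereal (?f n)) \<longlonglongrightarrow> \<infinity>"
      by (simp add: tendsto_PInfty_eq_at_top)
    then have "liminf (\<lambda>n. ereal (?f n)) = \<infinity>" by (intro lim_imp_Liminf) auto
    then have "limit_radius m P = \<infinity>" using irr by (simp add: irregular_vector_def)
    then have norm0: "poly_norm P = 0" by (auto simp: limit_radius_def split: if_splits)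
    obtain \<delta> where \<delta>: "\<delta> > 0" "\<And>y. norm y < \<delta> \<Longrightarrow> norm (P y) \<le> norm y / 2"
      using homogeneous_contraction_near_0[OF hom \<open>m \<ge> 2\<close> cont] by blast
    \<comment> \<open>Half of \<delta>, since the contraction estimate holds only strictly inside
      the \<delta>-ball.\<close>
    define c where "c = \<delta> / 2"
    have c: "c > 0" using \<delta> by (simp add: c_def)
    \<comment> \<open>The real supremum in \<open>poly_norm\<close> is sure to dominate the values
      only once they are bounded; the estimate at radius \<open>c\<close> is scaled up to the unit
      ball.\<close>
    have bdd: "bdd_above ((\<lambda>x. norm (P x)) ` cball 0 1)"
    proof (rule bdd_aboveI2)
      fix y :: 'a assume "y \<in> cball 0 1"
      then have y: "norm y \<le> 1" by simp
      have le: "norm (c *\<^sub>R y) \<le> c" using y c by (simp add: mult_left_le)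
      also have "c < \<delta>" using \<delta> by (simp add: c_def)
      finally have "norm (P (c *\<^sub>R y)) \<le> norm (c *\<^sub>R y) / 2" by (rule \<delta>)
      with le have "norm (P (c *\<^sub>R y)) \<le> c / 2" by linarith
      then show "norm (P y) \<le> c / 2 / c ^ m" using c by (simp add: hom field_simps)
    qed
    have P0: "P y = 0" for y
    proof (cases "y = 0")
      case True
      then show ?thesis using hom[of 0 0] \<open>m \<ge> 2\<close> by (simp add: power_0_left)
    next
      case False
      have "norm (P ((1 / norm y) *\<^sub>R y)) \<le> poly_norm P"
        unfolding poly_norm_def by (rule cSUP_upper[OF _ bdd]) simp
      then have "(1 / norm y) ^ m *\<^sub>R P y = 0"
        using norm0 by (simp only: hom norm_le_zero_iff)
      then show ?thesis using False by simp
    qed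
    \<comment> \<open>The shift skips index 0, where the iterate is \<open>x\<close> itself.\<close>
    have "?f (Suc n) = 0" for n by (simp add: P0)
    then have "(\<lambda>n. ?f (Suc n)) \<longlonglongrightarrow> 0" by simp
    then have "?f \<longlonglongrightarrow> 0" by (rule LIMSEQ_imp_Suc)
    with not0 show False ..
  qed
qed

text \<open>Along the multiples of a period the norms are constantly \<open>norm x\<close>, so any
  limit of the whole sequence is a limit of this constant one.\<close>

lemma periodic_vector_limits:
  fixes P :: "'a::real_normed_vector \<Rightarrow> 'a"
  assumes "periodic_vector P x"
  shows "(\<lambda>n. norm ((P ^^ n) x)) \<longlonglongrightarrow> 0 \<Longrightarrow> x = 0"
    and "\<not> filterlim (\<lambda>n. norm ((P ^^ n) x)) at_top sequentially"
proof -
  obtain k where k: "k \<ge> 1" "(P ^^ k) x = x" using assms unfolding periodic_vector_def by blast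
  have per: "(P ^^ (k * n)) x = x" for n
    by (induction n) (simp_all add: k funpow_add)
  have sub: "filterlim (\<lambda>n. k * n) sequentially sequentially"
    using k by (intro filterlim_subseq) (simp add: strict_mono_def)
  \<comment> \<open>The filter \<open>L\<close> is left general to serve both the limit 0 and the
    limit infinity.\<close>
  have along: "filterlim (\<lambda>n. norm ((P ^^ (k * n)) x)) L sequentially"
    if "filterlim (\<lambda>n. norm ((P ^^ n) x)) L sequentially" for L
    using filterlim_compose[OF that sub] .
  show "x = 0" if "(\<lambda>n. norm ((P ^^ n) x)) \<longlonglongrightarrow> 0"
    using along[OF that] by (simp add: per LIMSEQ_const_iff)
  show "\<not> filterlim (\<lambda>n. norm ((P ^^ n) x)) at_top sequentially"
  proof
    assume "filterlim (\<lambda>n. norm ((P ^^ n) x)) at_top sequentially"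
    from along[OF this] have "filterlim (\<lambda>n::nat. norm x) at_top sequentially" by (simp add: per)
    then have "\<forall>\<^sub>F n::nat in sequentially. norm x + 1 \<le> norm x"
      unfolding filterlim_at_top by blast
    then show False by simp
  qed
qed

text \<open>A nonzero vector is assumed because in the zero space the orbit of 0 is the whole
  space.\<close>

theorem corollary2p14:
  fixes smul :: "'k::real_normed_field \<Rightarrow> 'a::real_normed_vector \<Rightarrow> 'a"
    and m :: nat
    and P :: "'a \<Rightarrow> 'a"
  assumes "normed_space_over smul"
    and "\<exists>x::'a. x \<noteq> 0"
    and "m \<ge> 2"
    and "homogeneous_polynomial smul m P"
    and "continuous_on UNIV P"
  shows "(\<forall>x. nowhere_dense (poly_orbit P x)) \<and>
         nowhere_dense {x. irregular_vector m P x} \<and>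
         nowhere_dense {x. periodic_vector P x}"
proof -
  obtain w :: 'a where w: "w \<noteq> 0" using assms(2) by blast
  have hom: "P (c *\<^sub>R x) = c ^ m *\<^sub>R P x" for c x
    by (rule homogeneous_polynomial_scaleR[OF assms(1,4)])
  obtain \<delta> where \<delta>: "\<delta> > 0" "\<And>y. norm y < \<delta> \<Longrightarrow> norm (P y) \<le> norm y / 2"
    using homogeneous_contraction_near_0[OF hom assms(3,5)] by blast
  have crit: "nowhere_dense S"
    if not0: "\<And>x. x \<in> S \<Longrightarrow> x \<noteq> 0 \<Longrightarrow> \<not> (\<lambda>n. norm ((P ^^ n) x)) \<longlonglongrightarrow> 0"
      and not_inf: "\<And>x. x \<in> S \<Longrightarrow> x \<noteq> 0 \<Longrightarrow> \<not> filterlim (\<lambda>n. norm ((P ^^ n) x)) at_top sequentially"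
    for S
  proof (rule nowhere_dense_if_shrinking_escapes[OF hom assms(3,5) w \<delta>(1)])
    show "\<delta> \<le> norm ((P ^^ n) x)" if "x \<in> S" "x \<noteq> 0" for x n
      using not0[OF that] funpow_tendsto_0[OF \<delta>(2)] by (meson not_less)
  qed (use not_inf in blast)
  have "nowhere_dense (poly_orbit P x)" for x
  proof -
    have orbit: "poly_orbit P x = range (\<lambda>n. (P ^^ n) x)" by (auto simp: poly_orbit_def)
    let ?f = "\<lambda>n. norm ((P ^^ n) x)"
    consider "?f \<longlonglongrightarrow> 0" | "filterlim ?f at_top sequentially"
      | "\<not> ?f \<longlonglongrightarrow> 0" "\<not> filterlim ?f at_top sequentially" by blast
    then show ?thesis
    proof cases
      case 1
      then show ?thesis unfolding orbit by (rule nowhere_dense_range_if_tendsto_0[OF w])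
    next
      case 2
      then show ?thesis unfolding orbit by (rule nowhere_dense_range_if_norm_at_top[OF w])
    next
      case 3
      \<comment> \<open>The orbit itself is the set given to \<open>crit\<close>: each of its points
        has a tail of the orbit of \<open>x\<close> as its own orbit, with the same limit
        behaviour.\<close>
      have shift: "filterlim (\<lambda>n. norm ((P ^^ n) ((P ^^ k) x))) L sequentially
          \<longleftrightarrow> filterlim ?f L sequentially" for k and L :: "real filter"
      proof -
        have "(\<forall>\<^sub>F n in sequentially. Q (?f (n + k))) \<longleftrightarrow> (\<forall>\<^sub>F n in sequentially. Q (?f n))" for Q
          by (rule eventually_sequentially_seg)
        then show ?thesis
          unfolding filterlim_iff by (simp add: funpow_add)
      qed
      show ?thesis
        by (rule crit) (use 3 in \<open>auto simp: orbit shift\<close>)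
    qed
  qed
  moreover have "nowhere_dense {x. irregular_vector m P x}"
    by (rule crit) (use irregular_vector_limits[OF hom assms(3,5)] in auto)
  moreover have "nowhere_dense {x. periodic_vector P x}"
    by (rule crit) (use periodic_vector_limits in auto)
  ultimately show ?thesis by blast
qed

end
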